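(* For all integers $n\ge 3$ and $0\le k<n$, the pair $(\mathrm{cDes},\rho)$, with $\mathrm{cDes}$ and $\rho$ as defined in the context (restricted to $\mathbf M_{n,k}$), is a cyclic extension of $\mathrm{Des}$ on $\mathbf M_{n,k}$.
   Context: Write $[n]=\{1,\dots,n\}$ and let $2^{X}$ denote the power set of $X$. Cyclic extension. Let $\mathcal F$ be a finite set with a map $\mathrm{Des}:\mathcal F\to 2^{[n-1]}$. A cyclic extension of $\mathrm{Des}$ is a pair $(\mathrm{cDes},p)$, where $\mathrm{cDes}:\mathcal F\to 2^{[n]}$ is a map and $p:\mathcal F\to\mathcal F$ is a bijection, such that for all $F\in\mathcal F$: (extension) $\mathrm{cDes}(F)\cap[n-1]=\mathrm{Des}(F)$; (equivariance) $\mathrm{cDes}(p(F))=\mathrm{cDes}(F)+1$, where $1$ is added to every element modulo $n$ (so $n$ becomes $1$); (non-Escher) $\varnothing\subsetneq \mathrm{cDes}(F)\subsetneq[n]$. Motzkin paths. A Motzkin path of length $n$ is a lattice path from $(0,0)$ to $(n,0)$ with steps $U=(1,1)$, $D=(1,-1)$, $L=(1,0)$ that never passes below the $x$-axis; it is identified with its word of steps. $\mathbf M_n$ is the set of Motzkin paths of length $n$, $L^n$ is the path all of whose steps are $L$, $\mathbf M_n^*=\mathbf M_n\setminus\{L^n\}$, and $\mathbf M_{n,k}$ is the set of $M\in\mathbf M_n$ having exactly $k$ steps $L$. A return is a $D$ step ending on the $x$-axis; a start is a $U$ step starting on the $x$-axis. Descents (order $U>D>L$). $\mathrm{Des}(M)\subseteq[n-1]$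 is the set of $i$ such that the $i$th and $(i+1)$st steps of $M$ are $UD$, $UL$ or $DL$ (in this order). Cyclic descents. $\mathrm{cDes}(M)\cap[n-1]=\mathrm{Des}(M)$, and $n\in\mathrm{cDes}(M)$ if and only if one of the following holds: (1) the first step of $M$ is $L$ and the final step is $D$; (2) the first step of $M$ is $U$, the final step is $D$, and $M$ has no returns before the rightmost $D$. The map $\rho$. For $M\in\mathbf M_n^*$: (1) if the final step of $M$ is $L$, write $M=PL$ and set $\rho M=LP$; (2) if the final step of $M$ is $D$, write $M=PUP'D$, where the displayed $U$ is the last start step of $M$ and $P,P'$ are (possibly empty) Motzkin paths, and set $\rho M=UPDP'$. *)

theory Defs
  imports Main
begin

text \<open>
  Throughout, \<open>[n]\<close> is \<open>{1..n}\<close>, \<open>[n - 1]\<close> is \<open>{1..<n}\<close>, and the steps of a path are numbered from 1.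
\<close>

text \<open>For \<open>i\<close> in \<open>[n]\<close>, \<open>i mod n + 1\<close> is \<open>i + 1\<close> if \<open>i < n\<close>, and \<open>1\<close> if \<open>i = n\<close>.\<close>

definition cyclic_shift :: "nat \<Rightarrow> nat set \<Rightarrow> nat set" where
  "cyclic_shift n S = (\<lambda>i. i mod n + 1) ` S"

definition cyclic_extension ::
  "nat \<Rightarrow> 'a set \<Rightarrow> ('a \<Rightarrow> nat set) \<Rightarrow> ('a \<Rightarrow> nat set) \<Rightarrow> ('a \<Rightarrow> 'a) \<Rightarrow> bool" where
  "cyclic_extension n \<F> Des cDes p \<longleftrightarrow>
     finite \<F> \<and>
     (\<forall>F\<in>\<F>. Des F \<subseteq> {1..<n}) \<and>
     (\<forall>F\<in>\<F>. cDes F \<subseteq> {1..n}) \<and>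
     bij_betw p \<F> \<F> \<and>
     (\<forall>F\<in>\<F>. cDes F \<inter> {1..<n} = Des F) \<and>
     (\<forall>F\<in>\<F>. cDes (p F) = cyclic_shift n (cDes F)) \<and>
     (\<forall>F\<in>\<F>. {} \<subset> cDes F \<and> cDes F \<subset> {1..n})"

datatype step = U | D | L

fun rise :: "step \<Rightarrow> int" where
  "rise U = 1"
| "rise D = - 1"
| "rise L = 0"

text \<open>The ordinate of the path with word \<open>M\<close> after its first \<open>i\<close> steps.\<close>

definition height :: "step list \<Rightarrow> nat \<Rightarrow> int" where
  "height M i = sum_list (map rise (take i M))"

definition motzkin :: "nat \<Rightarrow> step list set" where
  "motzkin n = {M. length M = n \<and> (\<forall>i\<le>n. 0 \<le> height M i) \<and> height M n = 0}"

definition motzkin_level :: "nat \<Rightarrow> nat \<Rightarrow> step list set" where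
  "motzkin_level n k = {M \<in> motzkin n. count_list M L = k}"

definition positions :: "step \<Rightarrow> step list \<Rightarrow> nat set" where
  "positions s M = {i \<in> {1..length M}. M ! (i - 1) = s}"

definition starts :: "step list \<Rightarrow> nat set" where
  "starts M = {i \<in> positions U M. height M (i - 1) = 0}"

definition returns :: "step list \<Rightarrow> nat set" where
  "returns M = {i \<in> positions D M. height M i = 0}"

definition Des :: "step list \<Rightarrow> nat set" where
  "Des M = {i \<in> {1..<length M}. (M ! (i - 1), M ! i) \<in> {(U, D), (U, L), (D, L)}}"

text \<open>
  The two conditions under which \<open>n\<close> is a cyclic descent of a path of length \<open>n > 0\<close>.
\<close>

definition descent_at_end :: "step list \<Rightarrow> bool" where
  "descent_at_end M \<longleftrightarrow>
     (hd M = L \<and> last M = D) \<or>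
     (hd M = U \<and> last M = D \<and> \<not> (\<exists>i\<in>returns M. i < Max (positions D M)))"

definition cDes :: "step list \<Rightarrow> nat set" where
  "cDes M = Des M \<union> (if descent_at_end M then {length M} else {})"

text \<open>
  If the final step is \<open>D\<close>, then \<open>M = P @ [U] @ P' @ [D]\<close>, where the displayed \<open>U\<close>, at
  position \<open>j\<close>, is the last start.  The map is only meaningful on Motzkin paths with at least
  one step other than \<open>L\<close>; its values elsewhere are irrelevant.
\<close>

definition rho :: "step list \<Rightarrow> step list" where
  "rho M =
     (if last M = L then L # butlast M
      else let j = Max (starts M); P = take (j - 1) M; P' = butlast (drop j M)
           in [U] @ P @ [D] @ P')"

end

theory Submission
  imports Defs
begin

text \<open>
  The word \<open>P U P' D\<close> becomes \<open>U P D P'\<close>, so the descents inside \<open>P\<close> and \<open>P'\<close> move one place to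
  the right. Since a Motzkin path neither starts with \<open>D\<close> nor ends with \<open>U\<close>, the remaining
  positions are decided by whether \<open>P\<close> and \<open>P'\<close> are empty or start with \<open>L\<close>. The map is
  injective because the displayed \<open>D\<close> of \<open>U P D P'\<close> is its first return. Finally, the step after
  the last \<open>U\<close> produces a descent, and three cyclically consecutive descents ending at \<open>n\<close> are
  impossible.
\<close>

section \<open>Heights and balanced words\<close>

definition balanced :: "step list \<Rightarrow> bool" where
  "balanced M \<longleftrightarrow> (\<forall>i\<le>length M. 0 \<le> height M i) \<and> height M (length M) = 0"

text \<open>The predicate \<open>balanced\<close> carries no length parameter, so it applies equally
  to the factors \<open>P\<close> and \<open>P'\<close> of a path.\<close>

lemma motzkin_level_iff:
  "M \<in> motzkin_level n k \<longleftrightarrow> balanced M \<and> length M = n \<and> count_list M L = k"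
  by (auto simp: motzkin_level_def motzkin_def balanced_def)

lemma height_0 [simp]: "height M 0 = 0"
  by (simp add: height_def)

lemma height_append:
  "height (A @ B) i =
    (if i \<le> length A then height A i else height A (length A) + height B (i - length A))"
  by (simp add: height_def)

lemma height_Cons: "height (s # M) (Suc i) = rise s + height M i"
  by (simp add: height_def)

lemma height_single: "height [s] i = (if i = 0 then 0 else rise s)"
  by (simp add: height_def take_Cons')

lemma height_Suc: "i < length M \<Longrightarrow> height M (Suc i) = height M i + rise (M ! i)"
  by (simp add: height_def take_Suc_conv_app_nth)

lemma height_take: "j \<le> i \<Longrightarrow> height (take i M) j = height M j"
  by (simp add: height_def min_def)

lemma balanced_nonneg: "balanced M \<Longrightarrow> i \<le> length M \<Longrightarrow> 0 \<le> height M i"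
  by (simp add: balanced_def)

lemma balanced_total: "balanced M \<Longrightarrow> height M (length M) = 0"
  by (simp add: balanced_def)

lemma balanced_append: "balanced A \<Longrightarrow> balanced B \<Longrightarrow> balanced (A @ B)"
  by (auto simp: balanced_def height_append)

lemma balanced_L: "balanced [L]"
  by (simp add: balanced_def height_single)

lemma balanced_arch:
  assumes "balanced P"
  shows "balanced (U # P @ [D])"
  unfolding balanced_def
proof (intro conjI allI impI)
  fix i assume "i \<le> length (U # P @ [D])"
  then show "0 \<le> height (U # P @ [D]) i"
    using balanced_nonneg[OF assms] balanced_total[OF assms]
    by (cases i) (auto simp: height_Cons height_append height_single)
next
  show "height (U # P @ [D]) (length (U # P @ [D])) = 0"
    using balanced_total[OF assms] by (simp add: height_Cons height_append height_single)
qed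

lemma balanced_hd:
  assumes "balanced M" "M \<noteq> []"
  shows "M ! 0 \<noteq> D"
proof
  assume "M ! 0 = D"
  moreover have "height M (Suc 0) = rise (M ! 0)"
    using assms(2) by (simp add: height_Suc)
  ultimately show False
    using balanced_nonneg[OF assms(1), of "Suc 0"] assms(2) by (simp add: Suc_le_eq)
qed

lemma balanced_last:
  assumes "balanced M" "M \<noteq> []"
  shows "M ! (length M - 1) \<noteq> U"
proof
  assume "M ! (length M - 1) = U"
  then have "height M (length M) = height M (length M - 1) + 1"
    using height_Suc[of "length M - 1" M] assms(2) by simp
  then show False
    using balanced_nonneg[OF assms(1), of "length M - 1"] balanced_total[OF assms(1)] by simp
qed

section \<open>Decomposition according to the last step\<close>

lemma balanced_snoc_L:
  assumes "balanced M" "M \<noteq> []" "last M = L"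
  obtains P where "M = P @ [L]" "balanced P"
proof -
  obtain P where M: "M = P @ [L]"
    using assms(2,3) by (metis append_butlast_last_id)
  have "balanced P"
    unfolding balanced_def
  proof (intro conjI allI impI)
    fix i assume "i \<le> length P"
    then show "0 \<le> height P i"
      using balanced_nonneg[OF assms(1), of i] by (simp add: M height_append)
  next
    show "height P (length P) = 0"
      using balanced_total[OF assms(1)] by (simp add: M height_append height_single)
  qed
  with M that show thesis by blast
qed

text \<open>Cut at the last visit to the axis before the end. From there to the final
  \<open>D\<close> the path stays at height at least 1, so it leaves the axis by \<open>U\<close>,
  and the part in between is balanced once lowered by 1.\<close>

lemma balanced_snoc_D:
  assumes "balanced M" "M \<noteq> []" "last M = D"
  obtains P P' where "M = P @ U # P' @ [D]" "balanced P" "balanced P'"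
proof -
  define n where "n = length M"
  \<comment> \<open>The last visit to the axis before the end of the path.\<close>
  define a where "a = Max {i. i < n \<and> height M i = 0}"
  have n0: "n > 0" using assms(2) by (simp add: n_def)
  have fin: "finite {i. i < n \<and> height M i = 0}" by simp
  have a: "a < n" "height M a = 0"
    using Max_in[OF fin] n0 height_0[of M] unfolding a_def by blast+
  have pos: "1 \<le> height M i" if "a < i" "i < n" for i
  proof -
    have "height M i \<noteq> 0"
      using Max_ge[OF fin, of i] that unfolding a_def by fastforce
    with balanced_nonneg[OF assms(1), of i] that show ?thesis by (simp add: n_def)
  qed
  have lastD: "M ! (n - 1) = D"
    using assms(2,3) by (simp add: last_conv_nth n_def)
  have pen: "height M (n - 1) = 1"
    using height_Suc[of "n - 1" M] balanced_total[OF assms(1)] n0 lastD by (simp add: n_def)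
  \<comment> \<open>The height before the final \<open>D\<close> is 1, so the last visit to the axis
    is not at \<open>n - 1\<close>.\<close>
  then have an: "Suc a < n"
    using a by (metis Suc_lessI diff_Suc_1 zero_neq_one)
  have "height M (Suc a) = rise (M ! a)"
    using height_Suc[of a M] a by (simp add: n_def)
  with pos[of "Suc a"] an have Ma: "M ! a = U"
    by (cases "M ! a") auto
  define P where "P = take a M"
  define P' where "P' = drop (Suc a) (take (n - 1) M)"
  have t: "take (n - 1) M = P @ U # P'"
    using id_take_nth_drop[of a "take (n - 1) M"] an Ma
    by (simp add: P_def P'_def n_def min_absorb1)
  have M: "M = P @ U # P' @ [D]"
    using take_Suc_conv_app_nth[of "n - 1" M] n0 lastD t by (simp add: n_def)
  have lP: "length P = a" using a by (simp add: P_def n_def)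
  have hM: "height M (Suc (a + i)) = 1 + height P' i" if "i \<le> length P'" for i
    using that a lP by (simp add: M height_append height_Cons)
  have bP: "balanced P"
    using balanced_nonneg[OF assms(1)] a lP
    by (auto simp: balanced_def P_def n_def height_take)
  have ln: "n = a + length P' + 2"
    using arg_cong[OF M, of length] lP by (simp add: n_def)
  have bP': "balanced P'"
    unfolding balanced_def
  proof (intro conjI allI impI)
    fix i assume i: "i \<le> length P'"
    show "0 \<le> height P' i" using pos[of "Suc (a + i)"] hM[OF i] i ln by simp
  next
    show "height P' (length P') = 0" using hM[of "length P'"] pen ln by simp
  qed
  show thesis using that[OF M bP bP'] .
qed

text \<open>Between the displayed \<open>U\<close> and the final \<open>D\<close> the height is at
  least 1, so no later \<open>U\<close> leaves the axis. Hence \<open>rho\<close> cuts the word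
  exactly at this \<open>U\<close>.\<close>

lemma last_start:
  assumes "balanced P" "balanced P'"
  shows "Max (starts (P @ U # P' @ [D])) = Suc (length P)"
proof (rule Max_eqI)
  show "finite (starts (P @ U # P' @ [D]))"
    by (simp add: starts_def positions_def)
  show "Suc (length P) \<in> starts (P @ U # P' @ [D])"
    using balanced_total[OF assms(1)]
    by (simp add: starts_def positions_def height_append nth_append)
next
  fix i assume i: "i \<in> starts (P @ U # P' @ [D])"
  show "i \<le> Suc (length P)"
  proof (rule ccontr)
    assume "\<not> i \<le> Suc (length P)"
    then obtain t where t: "i = length P + 2 + t"
      by (metis add.commute add_2_eq_Suc' le_Suc_ex not_less_eq_eq)
    then have "t \<le> length P'" using i by (simp add: starts_def positions_def)
    moreover have "height (P @ U # P' @ [D]) (Suc (length P + t)) = 0"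
      using i t by (simp add: starts_def)
    ultimately show False
      using balanced_total[OF assms(1)] balanced_nonneg[OF assms(2), of t]
      by (simp add: height_append height_Cons)
  qed
qed

section \<open>The map on paths and its injectivity\<close>

lemma rho_snoc_L [simp]: "rho (P @ [L]) = L # P"
  by (simp add: rho_def)

lemma rho_snoc_D:
  assumes "balanced P" "balanced P'"
  shows "rho (P @ U # P' @ [D]) = U # P @ D # P'"
  using last_start[OF assms] by (simp add: rho_def Let_def butlast_append)

text \<open>The image is a concatenation of balanced words: \<open>L\<close> and \<open>P\<close>,
  or the arch over \<open>P\<close> followed by \<open>P'\<close>. The letters are only
  rearranged.\<close>

lemma rho_balanced:
  assumes "balanced M" "M \<noteq> []"
  shows "balanced (rho M)" "length (rho M) = length M" "count_list (rho M) L = count_list M L"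
proof -
  have "balanced (rho M) \<and> length (rho M) = length M \<and> count_list (rho M) L = count_list M L"
  proof (cases "last M = L")
    case True
    then obtain P where "M = P @ [L]" "balanced P" using balanced_snoc_L assms by blast
    then show ?thesis using balanced_append[OF balanced_L, of P] by simp
  next
    case False
    then have "last M = D"
      using balanced_last[OF assms] assms(2) by (cases "last M") (auto simp: last_conv_nth)
    then obtain P P' where "M = P @ U # P' @ [D]" "balanced P" "balanced P'"
      using balanced_snoc_D assms by blast
    then show ?thesis
      using balanced_append[OF balanced_arch, of P P'] by (simp add: rho_snoc_D)
  qed
  then show "balanced (rho M)" "length (rho M) = length M"
    "count_list (rho M) L = count_list M L" by auto
qed

text \<open>A nonempty \<open>us\<close> would begin with \<open>D\<close>, taking \<open>P\<close>
  to height -1 right after its prefix \<open>Q\<close>.\<close>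

lemma balanced_D_prefix:
  assumes "balanced P" "P = Q @ us" "us @ D # P' = D # Q'" "balanced Q"
  shows "us = []"
proof (cases us)
  case (Cons u vs)
  then have "u = D" using assms(3) by simp
  then have "height P (Suc (length Q)) = -1"
    using balanced_total[OF assms(4)] Cons assms(2) by (simp add: height_append height_Cons)
  then show ?thesis
    using balanced_nonneg[OF assms(1), of "Suc (length Q)"] Cons assms(2) by simp
qed

text \<open>The displayed \<open>D\<close> is the first step to reach height -1. Formally, one of
  \<open>P\<close> and \<open>Q\<close> is a prefix of the other, and a proper prefix is excluded by
  the preceding lemma.\<close>

lemma first_return_unique:
  assumes "balanced P" "balanced Q" "P @ D # P' = Q @ D # Q'"
  shows "P = Q" "P' = Q'"
proof -
  obtain us where "P = Q @ us \<and> us @ D # P' = D # Q' \<or> P @ us = Q \<and> D # P' = us @ D # Q'"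
    using assms(3) by (auto simp: append_eq_append_conv2)
  then show "P = Q"
    using balanced_D_prefix[OF assms(1), of Q us P' Q'] balanced_D_prefix[OF assms(2), of P us Q' P']
      assms(1,2) by fastforce
  with assms(3) show "P' = Q'" by simp
qed

lemma rho_cases:
  assumes "balanced M" "M \<noteq> []"
  obtains (L) P where "M = P @ [L]" "balanced P" "rho M = L # P"
  | (D) P P' where "M = P @ U # P' @ [D]" "balanced P" "balanced P'" "rho M = U # P @ D # P'"
proof (cases "last M")
  case U
  then show ?thesis using balanced_last[OF assms] assms(2) by (simp add: last_conv_nth)
next
  case D
  then show ?thesis
    using balanced_snoc_D[OF assms] rho_snoc_D that(2) by metis
next
  case L
  then show ?thesis
    using balanced_snoc_L[OF assms] rho_snoc_L that(1) by metis
qed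

text \<open>The first letter of the image reveals which clause was applied. In the second clause,
  uniqueness of the first return recovers both factors.\<close>

lemma rho_inj:
  assumes "balanced M" "M \<noteq> []" "balanced N" "N \<noteq> []" "rho M = rho N"
  shows "M = N"
  using assms(1,2)
proof (cases rule: rho_cases)
  case (L P)
  show ?thesis using assms(3,4) by (cases rule: rho_cases) (use L assms(5) in auto)
next
  case M: (D P P')
  show ?thesis using assms(3,4)
  proof (cases rule: rho_cases)
    case (L Q)
    then show ?thesis using M assms(5) by simp
  next
    case (D Q Q')
    then have "P @ D # P' = Q @ D # Q'" using M assms(5) by simp
    then show ?thesis using first_return_unique M D by metis
  qed
qed

section \<open>Descents and the condition at the last position\<close>

lemma Suc_in_Des:
  "Suc i \<in> Des M \<longleftrightarrow>
    Suc i < length M \<and> (M ! i, M ! Suc i) \<in> {(U, D), (U, L), (D, L)}"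
  by (auto simp: Des_def)

lemma Des_subset: "Des M \<subseteq> {1..<length M}"
  by (auto simp: Des_def)

lemma in_cDes:
  "i \<in> cDes M \<longleftrightarrow> (if i = length M then descent_at_end M else i \<in> Des M)"
  by (auto simp: cDes_def Des_def)

lemma positions_D_Max:
  assumes "M \<noteq> []" "last M = D"
  shows "Max (positions D M) = length M"
proof (rule Max_eqI)
  show "length M \<in> positions D M"
    using assms by (auto simp: positions_def last_conv_nth Suc_le_eq)
qed (auto simp: positions_def)

text \<open>Both clauses demand a final \<open>D\<close>, which is then the rightmost one, so
  \<open>Max\<close> gives way to the length.\<close>

lemma descent_at_end_iff:
  assumes "M \<noteq> []"
  shows "descent_at_end M \<longleftrightarrow>
    last M = D \<and> (hd M = L \<or> hd M = U \<and> (\<forall>i\<in>returns M. i \<ge> length M))"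
  using positions_D_Max[OF assms] by (auto simp: descent_at_end_def not_less)

lemma descent_at_end_arch:
  assumes "balanced P"
  shows "descent_at_end (U # P @ [D])"
proof -
  have "i \<ge> length (U # P @ [D])" if "i \<in> returns (U # P @ [D])" for i
  proof (rule ccontr)
    assume "\<not> ?thesis"
    moreover have "0 < i" using that by (simp add: returns_def positions_def)
    ultimately obtain t where t: "i = Suc t" "t \<le> length P"
      by (cases i) auto
    then show False
      using that balanced_nonneg[OF assms, of t]
      by (simp add: returns_def height_Cons height_append)
  qed
  then show ?thesis by (simp add: descent_at_end_iff)
qed

text \<open>The displayed \<open>D\<close> is a return, and a nonempty \<open>P'\<close> puts it
  before the end.\<close>

lemma not_descent_at_end:
  assumes "balanced P" "P' \<noteq> []"
  shows "\<not> descent_at_end (U # P @ D # P')"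
proof -
  have "Suc (Suc (length P)) \<in> returns (U # P @ D # P')"
    using balanced_total[OF assms(1)]
    by (simp add: returns_def positions_def nth_append height_append height_Cons)
  then show ?thesis using assms(2) by (force simp: descent_at_end_iff)
qed

text \<open>The path first comes back to the axis from a positive height, hence by a
  \<open>D\<close>.\<close>

lemma balanced_returns:
  assumes "balanced P" "P \<noteq> []" "hd P = U"
  shows "returns P \<noteq> {}"
proof -
  \<comment> \<open>Searching among heights at \<open>Suc i\<close> skips the origin, where the
    height is trivially 0.\<close>
  define i where "i = (LEAST i. height P (Suc i) = 0)"
  have ex: "height P (Suc (length P - 1)) = 0"
    using balanced_total[OF assms(1)] assms(2) by simp
  have i: "height P (Suc i) = 0" unfolding i_def using ex by (rule LeastI)
  have "i \<le> length P - 1" unfolding i_def using ex by (rule Least_le)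
  then have il: "i < length P" using assms(2) by (cases P) auto
  have one: "height P (Suc 0) = 1"
    using assms(2,3) by (simp add: height_Suc hd_conv_nth)
  obtain j where j: "i = Suc j" using i one by (cases i) auto
  have "height P i \<noteq> 0"
    using not_less_Least[of j "\<lambda>i. height P (Suc i) = 0"] j unfolding i_def by simp
  then have "rise (P ! i) < 0"
    using height_Suc[OF il] i balanced_nonneg[OF assms(1), of i] il by simp
  then have "P ! i = D" by (cases "P ! i") auto
  then have "Suc i \<in> returns P" using il i by (simp add: returns_def positions_def)
  then show ?thesis by blast
qed

lemma returns_append: "returns P \<subseteq> returns (P @ Q)"
  by (auto simp: returns_def positions_def nth_append height_append)

text \<open>If \<open>P\<close> starts with \<open>U\<close>, it contains a return, which violates
  the second clause; if it starts with \<open>L\<close>, the first clause applies.\<close>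

lemma descent_at_end_snoc:
  assumes "balanced P" "P \<noteq> []"
  shows "descent_at_end (P @ U # P' @ [D]) \<longleftrightarrow> hd P = L"
proof (cases "hd P")
  case U
  then obtain i where "i \<in> returns P" using balanced_returns assms by blast
  moreover from this have "i \<le> length P" by (simp add: returns_def positions_def)
  ultimately have "i \<in> returns (P @ U # P' @ [D])" "i < length (P @ U # P' @ [D])"
    using returns_append[of P "U # P' @ [D]"] by auto
  then show ?thesis using U assms(2) by (simp add: descent_at_end_iff) (meson not_le)
qed (use assms(2) in \<open>auto simp: descent_at_end_iff\<close>)

section \<open>Equivariance\<close>

lemma cyclic_shift_eqI:
  assumes "A \<subseteq> {1..n}" "B \<subseteq> {1..n}" "0 < n"
    and "1 \<in> A \<longleftrightarrow> n \<in> B"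
    and "\<And>i. 0 < i \<Longrightarrow> i < n \<Longrightarrow> Suc i \<in> A \<longleftrightarrow> i \<in> B"
  shows "A = cyclic_shift n B"
proof (intro set_eqI iffI)
  fix x assume x: "x \<in> A"
  then have xn: "1 \<le> x" "x \<le> n" using assms(1) by auto
  show "x \<in> cyclic_shift n B"
  proof (cases "x = 1")
    case True
    then show ?thesis using assms(4) x by (force simp: cyclic_shift_def)
  next
    case False
    then obtain i where i: "x = Suc i" "0 < i" "i < n" using xn by (cases x) auto
    then have "i \<in> B" using assms(5) x by blast
    then show ?thesis using i by (force simp: cyclic_shift_def)
  qed
next
  fix x assume "x \<in> cyclic_shift n B"
  then obtain i where i: "i \<in> B" "x = i mod n + 1" by (auto simp: cyclic_shift_def)
  then have "0 < i" "i \<le> n" using assms(2) by auto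
  then show "x \<in> A"
    using i assms(4) assms(5)[of i] by (cases "i = n") auto
qed

lemma cDes_subset: "M \<noteq> [] \<Longrightarrow> cDes M \<subseteq> {1..length M}"
  using Des_subset[of M] by (auto simp: cDes_def Suc_le_eq)

text \<open>At the wrap-around both memberships fail: \<open>L\<close> never begins a descent, and a
  path ending in \<open>L\<close> has no cyclic descent at its end.\<close>

lemma cDes_rho_L:
  assumes "balanced P" "P \<noteq> []"
  shows "cDes (L # P) = cyclic_shift (Suc (length P)) (cDes (P @ [L]))"
proof (rule cyclic_shift_eqI)
  show "cDes (L # P) \<subseteq> {1..Suc (length P)}" "cDes (P @ [L]) \<subseteq> {1..Suc (length P)}"
    using cDes_subset[of "L # P"] cDes_subset[of "P @ [L]"] by auto
  show "1 \<in> cDes (L # P) \<longleftrightarrow> Suc (length P) \<in> cDes (P @ [L])"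
    using assms(2) Suc_in_Des[of 0 "L # P"] by (simp add: in_cDes descent_at_end_iff)
next
  fix i assume i: "0 < i" "i < Suc (length P)"
  then obtain j where j: "i = Suc j" "j < length P" by (cases i) auto
  show "Suc i \<in> cDes (L # P) \<longleftrightarrow> i \<in> cDes (P @ [L])"
  proof (cases "i = length P")
    \<comment> \<open>At the junction both sides say that \<open>P\<close> ends with
      \<open>D\<close>, since it cannot end with \<open>U\<close>.\<close>
    case True
    have "P ! j \<noteq> U" using balanced_last[OF assms] True j by (metis diff_Suc_1)
    moreover have "last P = P ! j" using True j assms(2) by (metis diff_Suc_1 last_conv_nth)
    ultimately show ?thesis using True j assms(2) Suc_in_Des[of j "P @ [L]"]
      by (cases "P ! j") (simp_all add: in_cDes descent_at_end_iff nth_append)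
  next
    case False
    then show ?thesis using j by (simp add: in_cDes Suc_in_Des nth_append)
  qed
qed simp

lemma cDes_rho_D:
  assumes "balanced P" "balanced P'"
  shows "cDes (U # P @ D # P') =
    cyclic_shift (length P + length P' + 2) (cDes (P @ U # P' @ [D]))"
    (is "cDes ?R = cyclic_shift ?n (cDes ?M)")
proof (rule cyclic_shift_eqI)
  show "cDes ?R \<subseteq> {1..?n}" "cDes ?M \<subseteq> {1..?n}"
    using cDes_subset[of ?R] cDes_subset[of ?M] by auto
  \<comment> \<open>If \<open>P\<close> is empty, both sides hold: the image starts with
    \<open>UD\<close> and the source is an arch. Otherwise both say that \<open>P\<close> starts
    with \<open>L\<close>.\<close>
  show "1 \<in> cDes ?R \<longleftrightarrow> ?n \<in> cDes ?M"
  proof (cases "P = []")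
    case True
    then show ?thesis
      using assms(2) Suc_in_Des[of 0 ?R] descent_at_end_arch[of P'] descent_at_end_arch[of "[]"]
      by (simp add: in_cDes)
  next
    case False
    then show ?thesis
      using balanced_hd[OF assms(1)] Suc_in_Des[of 0 ?R]
      by (cases "P ! 0") (simp_all add: in_cDes descent_at_end_snoc[OF assms(1)] hd_conv_nth nth_append)
  qed
next
  fix i assume i: "0 < i" "i < ?n"
  then obtain j where j: "i = Suc j" by (cases i) auto
  \<comment> \<open>The cases follow the source word: inside \<open>P\<close>, end of
    \<open>P\<close>, the displayed \<open>U\<close>, inside \<open>P'\<close>, end of
    \<open>P'\<close>. Here \<open>t\<close> is the zero-based index in \<open>P'\<close>.\<close>
  consider "i < length P" | "i = length P" | "i = Suc (length P)"
    | t where "i = length P + 2 + t" "Suc t < length P'" | t where "i = length P + 2 + t" "Suc t = length P'"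
  proof -
    assume *: "i < length P \<Longrightarrow> thesis" "i = length P \<Longrightarrow> thesis" "i = Suc (length P) \<Longrightarrow> thesis"
      "\<And>t. \<lbrakk>i = length P + 2 + t; Suc t < length P'\<rbrakk> \<Longrightarrow> thesis"
      "\<And>t. \<lbrakk>i = length P + 2 + t; Suc t = length P'\<rbrakk> \<Longrightarrow> thesis"
    show thesis using *(1-3) *(4,5)[of "i - (length P + 2)"] i by linarith
  qed
  then show "Suc i \<in> cDes ?R \<longleftrightarrow> i \<in> cDes ?M"
  proof cases
    case 1
    then show ?thesis using j by (simp add: in_cDes Suc_in_Des nth_append)
  next
    \<comment> \<open>Both sides fail: \<open>P\<close> does not end with \<open>U\<close>, so no
      descent arises when \<open>D\<close> or \<open>U\<close> follows it.\<close>
    case 2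
    then have "P \<noteq> []" using i by auto
    then have "P ! j \<noteq> U" using balanced_last[OF assms(1)] 2 j by (metis diff_Suc_1)
    moreover have "length P = Suc j" using 2 j by simp
    ultimately show ?thesis using j by (simp add: in_cDes Suc_in_Des nth_append)
  next
    \<comment> \<open>If \<open>P'\<close> is empty, both sides hold, the image being an arch.
      Otherwise \<open>P'\<close> starts with \<open>U\<close> or \<open>L\<close>, and replacing
      the preceding \<open>U\<close> by \<open>D\<close> does not affect the descent.\<close>
    case 3
    show ?thesis
    proof (cases "P' = []")
      case True
      then show ?thesis
        using 3 descent_at_end_arch[OF assms(1)]
        by (simp add: in_cDes Suc_in_Des nth_append)
    next
      case False
      then show ?thesis
        using 3 balanced_hd[OF assms(2)]
        by (cases "P' ! 0") (simp_all add: in_cDes Suc_in_Des nth_append)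
    qed
  next
    case (4 t)
    then show ?thesis by (simp add: in_cDes Suc_in_Des nth_append)
  next
    \<comment> \<open>Both sides fail: \<open>P'\<close> does not end with \<open>U\<close>, and the
      return before \<open>P'\<close> prevents a cyclic descent at the end of the image.\<close>
    case (5 t)
    then have ne: "P' \<noteq> []" by auto
    then have "P' ! t \<noteq> U" using balanced_last[OF assms(2)] 5 by (metis diff_Suc_1)
    moreover have "length P' = Suc t" using 5 by simp
    ultimately show ?thesis using 5(1) not_descent_at_end[OF assms(1) ne]
      by (simp add: in_cDes Suc_in_Des nth_append)
  qed
qed simp

lemma cDes_rho:
  assumes "balanced M" "length M \<ge> 2"
  shows "cDes (rho M) = cyclic_shift (length M) (cDes M)"
proof -
  have "M \<noteq> []" using assms(2) by auto
  with assms(1) show ?thesis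
  proof (cases rule: rho_cases)
    case (L P)
    then have "P \<noteq> []" using assms(2) by auto
    then show ?thesis using L cDes_rho_L[of P] by simp
  next
    case (D P P')
    then show ?thesis using cDes_rho_D[of P P'] by simp
  qed
qed

section \<open>The non-Escher property\<close>

lemma balanced_no_U:
  assumes "balanced M" "U \<notin> set M"
  shows "set M \<subseteq> {L}"
proof -
  have "M ! i = L" if "i < length M" for i
    using that
  proof (induction i rule: less_induct)
    case (less i)
    \<comment> \<open>By induction all earlier steps are \<open>L\<close>, so the path is still on
      the axis and a \<open>D\<close> would go below it.\<close>
    have "height M j = 0" if "j \<le> i" for j
      using that by (induction j) (use less in \<open>auto simp: height_Suc\<close>)
    then have "height M (Suc i) = rise (M ! i)" using less.prems by (simp add: height_Suc)
    then have "M ! i \<noteq> D" using balanced_nonneg[OF assms(1), of "Suc i"] less.prems by auto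
    moreover have "M ! i \<noteq> U" using assms(2) less.prems by (metis nth_mem)
    ultimately show ?case by (cases "M ! i") auto
  qed
  then show ?thesis by (auto simp: in_set_conv_nth)
qed

text \<open>A balanced word does not end with \<open>U\<close>, so its last \<open>U\<close> is
  followed by \<open>D\<close> or \<open>L\<close>.\<close>

lemma Des_nonempty:
  assumes "balanced M" "U \<in> set M"
  shows "Des M \<noteq> {}"
proof -
  obtain xs ys where M: "M = xs @ U # ys" "U \<notin> set ys"
    using split_list_last[OF assms(2)] by blast
  have "ys \<noteq> []"
    using balanced_last[OF assms(1)] M by auto
  then have "ys ! 0 \<noteq> U" using M(2) by (metis length_greater_0_conv nth_mem)
  then have "Suc (length xs) \<in> Des M"
    using M \<open>ys \<noteq> []\<close> by (cases "ys ! 0") (simp_all add: Suc_in_Des nth_append)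
  then show ?thesis by blast
qed

text \<open>A cyclic descent at the end forces a final \<open>D\<close>; a descent just before it
  forces the penultimate step to be \<open>U\<close>; but no descent has \<open>U\<close> as its
  second letter.\<close>

lemma cDes_not_full:
  assumes "length M \<ge> 3"
  shows "cDes M \<noteq> {1..length M}"
proof
  assume full: "cDes M = {1..length M}"
  obtain m where m: "length M = Suc (Suc (Suc m))"
    using assms by (metis One_nat_def Suc_le_D Suc_le_mono numeral_3_eq_3)
  have *: "length M \<in> cDes M" "Suc (Suc m) \<in> cDes M" "Suc m \<in> cDes M"
    using full m by auto
  have "last M = D" using *(1) m by (auto simp: in_cDes descent_at_end_def)
  moreover have "M \<noteq> []" using m by auto
  ultimately have "M ! Suc (Suc m) = D" using m by (simp add: last_conv_nth)
  then show False using *(2,3) m by (simp add: in_cDes Suc_in_Des)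
qed

section \<open>Assembling the cyclic extension\<close>

lemma finite_motzkin_level: "finite (motzkin_level n k)"
proof (rule finite_subset)
  show "motzkin_level n k \<subseteq> {M. set M \<subseteq> {U, D, L} \<and> length M = n}"
    using step.exhaust by (auto simp: motzkin_level_def motzkin_def)
  show "finite {M. set M \<subseteq> {U, D, L} \<and> length M = n}"
    by (rule finite_lists_length_eq) simp
qed

theorem theorem1p10:
  fixes n k :: nat
  assumes "n \<ge> 3" and "k < n"
  shows "cyclic_extension n (motzkin_level n k) Des cDes rho"
proof -
  have ne: "M \<noteq> []" if "M \<in> motzkin_level n k" for M
    using that assms(1) by (auto simp: motzkin_level_iff)
  have "rho ` motzkin_level n k \<subseteq> motzkin_level n k"
    using ne rho_balanced by (auto simp: motzkin_level_iff)
  moreover have inj: "inj_on rho (motzkin_level n k)"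
    using ne rho_inj by (auto simp: inj_on_def motzkin_level_iff)
  \<comment> \<open>An injective self-map of a finite set is onto, so no inverse has to be
    constructed.\<close>
  ultimately have "bij_betw rho (motzkin_level n k) (motzkin_level n k)"
    using endo_inj_surj[OF finite_motzkin_level] by (simp add: bij_betw_def)
  moreover have "Des M \<subseteq> {1..<n}" "cDes M \<subseteq> {1..n}" "cDes M \<inter> {1..<n} = Des M"
    "cDes (rho M) = cyclic_shift n (cDes M)" "{} \<subset> cDes M" "cDes M \<subset> {1..n}"
    if M: "M \<in> motzkin_level n k" for M
  proof -
    have b: "balanced M" "length M = n" "count_list M L = k"
      using M by (auto simp: motzkin_level_iff)
    show D: "Des M \<subseteq> {1..<n}" using Des_subset[of M] b(2) by simp
    show c: "cDes M \<subseteq> {1..n}" using cDes_subset[OF ne[OF M]] b(2) by simp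
    show "cDes M \<inter> {1..<n} = Des M" using D b(2) by (auto simp: cDes_def)
    show "cDes (rho M) = cyclic_shift n (cDes M)" using cDes_rho[OF b(1)] b(2) assms(1) by simp
    \<comment> \<open>Here \<open>k < n\<close> enters: without \<open>U\<close> the path would
      consist of \<open>n\<close> level steps.\<close>
    have "U \<in> set M"
    proof (rule ccontr)
      assume "U \<notin> set M"
      then have "M = replicate n L" using balanced_no_U[OF b(1)] b(2)
        by (metis replicate_eqI singletonD subsetD)
      then have "count_list M L = n" by (simp add: count_list_eq_length_filter)
      then show False using b(3) assms(2) by simp
    qed
    then show "{} \<subset> cDes M" using Des_nonempty[OF b(1)] by (auto simp: cDes_def)
    show "cDes M \<subset> {1..n}" using cDes_not_full[of M] c b(2) assms(1) by auto
  qed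
  ultimately show ?thesis
    by (simp add: cyclic_extension_def finite_motzkin_level)
qed

end
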